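(* Let $S$ be a semiring. Then the following statements hold: (1) $S[X]$ is reversible if and only if $S[X;X^{-1}]$ is reversible. (2) $S[X]$ is eversible if and only if $S[X;X^{-1}]$ is eversible.
   Context: A semiring is an algebraic structure $(S,+,\cdot,0,1)$ such that $(S,+,0)$ is a commutative monoid, $(S,\cdot,1)$ is a (not necessarily commutative) monoid with $1\neq 0$, $a(b+c)=ab+ac$ and $(b+c)a=ba+ca$ for all $a,b,c\in S$, and $a\cdot 0=0\cdot a=0$ for all $a\in S$. $S[X]$ and $S[X;X^{-1}]$ are the polynomial semiring and the Laurent polynomial semiring over $S$, with $X$ commuting with the coefficients. A semiring is reversible if $st=0$ implies $ts=0$ for all its elements $s,t$. An element $s$ is a left (resp. right) zero-divisor if there is a nonzero $x$ with $sx=0$ (resp. $xs=0$). A semiring is eversible if its set of left zero-divisors equals its set of right zero-divisors. *)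

theory Defs
  imports "HOL-Library.Poly_Mapping"
begin

(* A semiring, not necessarily commutative and with 1 \<noteq> 0, is a type of class semiring_1.
   The type 'a poly is not usable here: its multiplication requires commutative coefficients.
   Instead, S[X] and S[X;X^{-1}] are the finitely supported maps from exponents (in nat, resp.
   int) to coefficients, with the convolution product of HOL-Library.Poly_Mapping:
   the coefficient of p * q at k is the sum of p_i * q_j over i + j = k, in this order, so that
   X (that is, single 1 1) commutes with the constants single 0 s. *)

type_synonym 's polynomial = "nat \<Rightarrow>\<^sub>0 's"

type_synonym 's laurent_polynomial = "int \<Rightarrow>\<^sub>0 's"

definition reversible :: "'s::semiring_1 itself \<Rightarrow> bool" where
  "reversible (_ :: 's itself) \<longleftrightarrow> (\<forall>s t :: 's. s * t = 0 \<longrightarrow> t * s = 0)"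

(* 0 itself is a left and right zero-divisor, since x = 1 is then a nonzero witness. *)

definition left_zero_divisors :: "'s::semiring_1 set" where
  "left_zero_divisors = {s. \<exists>x. x \<noteq> 0 \<and> s * x = 0}"

definition right_zero_divisors :: "'s::semiring_1 set" where
  "right_zero_divisors = {s. \<exists>x. x \<noteq> 0 \<and> x * s = 0}"

definition eversible :: "'s::semiring_1 itself \<Rightarrow> bool" where
  "eversible (_ :: 's itself) \<longleftrightarrow> (left_zero_divisors :: 's set) = right_zero_divisors"

end

theory Submission
  imports Defs
begin

text \<open>\<open>S[X]\<close> embeds into \<open>S[X;X\<^sup>-\<^sup>1]\<close>, and multiplying a Laurent polynomial by a suitable power
  of the central unit \<open>X\<close> moves it into the image. Both the relation \<open>f * g = 0\<close> and the zero-divisor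
  sets are preserved and reflected by the embedding and by multiplication with \<open>X\<^sup>n\<close>.\<close>

abbreviation "single \<equiv> Poly_Mapping.single"
abbreviation "lookup \<equiv> Poly_Mapping.lookup"
abbreviation "keys \<equiv> Poly_Mapping.keys"

text \<open>A sum of monomials over \<open>keys p\<close> is finitely supported by construction, so
  no separate finiteness proof is required.\<close>

definition laurent_of_poly :: "'s::semiring_1 polynomial \<Rightarrow> 's laurent_polynomial" where
  "laurent_of_poly p = (\<Sum>k\<in>keys p. single (int k) (lookup p k))"

lemma lookup_laurent_of_poly:
  "lookup (laurent_of_poly p) k = (if 0 \<le> k then lookup p (nat k) else 0)"
proof -
  have "lookup (laurent_of_poly p) k = (\<Sum>i\<in>keys p. if int i = k then lookup p i else 0)"
    by (simp add: laurent_of_poly_def lookup_sum lookup_single when_def)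
  also have "\<dots> = (if 0 \<le> k then lookup p (nat k) else 0)"
  proof (cases "0 \<le> k")
    case True
    then have "(\<Sum>i\<in>keys p. if int i = k then lookup p i else 0)
        = (\<Sum>i\<in>keys p. if i = nat k then lookup p i else 0)"
      by (intro sum.cong) auto
    with True show ?thesis by (simp add: in_keys_iff)
  qed (auto intro!: sum.neutral)
  finally show ?thesis .
qed

lemma inj_laurent_of_poly: "inj laurent_of_poly"
proof (intro injI poly_mapping_eqI)
  fix p q :: "'s::semiring_1 polynomial" and k
  assume "laurent_of_poly p = laurent_of_poly q"
  then have "lookup (laurent_of_poly p) (int k) = lookup (laurent_of_poly q) (int k)" by simp
  then show "lookup p k = lookup q k" by (simp add: lookup_laurent_of_poly)
qed

lemma laurent_of_poly_zero [simp]: "laurent_of_poly 0 = 0"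
  by (simp add: laurent_of_poly_def)

lemma laurent_of_poly_eq_0_iff [simp]: "laurent_of_poly p = 0 \<longleftrightarrow> p = 0"
  using inj_eq[OF inj_laurent_of_poly, of p 0] by simp

lemma laurent_of_poly_add: "laurent_of_poly (p + q) = laurent_of_poly p + laurent_of_poly q"
  by (rule poly_mapping_eqI) (simp add: lookup_laurent_of_poly lookup_add)

lemma laurent_of_poly_single: "laurent_of_poly (single k a) = single (int k) a"
  by (rule poly_mapping_eqI) (auto simp: lookup_laurent_of_poly lookup_single when_def)

text \<open>Every finitely supported map is the sum of its monomials. Identities that are additive
  in \<open>f\<close> thereby reduce to monomials.\<close>

lemma poly_mapping_single_add_induct [case_names single add]:
  fixes f :: "'a \<Rightarrow>\<^sub>0 'b::comm_monoid_add"
  assumes single: "\<And>k a. P (single k a)" and add: "\<And>f g. P f \<Longrightarrow> P g \<Longrightarrow> P (f + g)"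
  shows "P f"
proof -
  have "P (\<Sum>k\<in>A. single k (lookup f k))" if "finite A" for A
    using that
  proof induction
    case empty
    \<comment> \<open>The zero map counts as a monomial with coefficient 0; its exponent is
      irrelevant.\<close>
    show ?case using single[of undefined 0] by simp
  qed (simp add: single add)
  moreover have "(\<Sum>k\<in>keys f. single k (lookup f k)) = f"
    by (rule poly_mapping_eqI) (simp add: lookup_sum lookup_single when_def in_keys_iff)
  ultimately show ?thesis by (metis finite_keys)
qed

text \<open>Both sides are additive in \<open>p\<close> and in \<open>q\<close>, and on monomials
  the claim is the additivity of \<open>int\<close> on exponents.\<close>

lemma laurent_of_poly_mult: "laurent_of_poly (p * q) = laurent_of_poly p * laurent_of_poly q"
proof (induction p rule: poly_mapping_single_add_induct)
  case (single k a)
  show ?case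
    by (induction q rule: poly_mapping_single_add_induct)
      (simp_all add: laurent_of_poly_single laurent_of_poly_add mult_single distrib_left)
qed (simp add: laurent_of_poly_add distrib_right)

text \<open>On monomials, exponents add commutatively and the coefficient 1 commutes with every
  element, even when the coefficients do not commute with each other.\<close>

lemma single_one_commute:
  fixes f :: "'a::comm_monoid_add \<Rightarrow>\<^sub>0 's::semiring_1"
  shows "single n 1 * f = f * single n 1"
  by (induction f rule: poly_mapping_single_add_induct)
    (simp_all add: mult_single add.commute distrib_left distrib_right)

text \<open>Exponents now form a group, so X^n is a unit with inverse X^(-n).\<close>

lemma single_one_cancel:
  fixes f :: "'a::ab_group_add \<Rightarrow>\<^sub>0 's::semiring_1"
  shows "single (- n) 1 * (single n 1 * f) = f"
  by (simp flip: mult.assoc add: mult_single)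

lemma single_one_mult_eq_0_iff [simp]:
  fixes f :: "'a::ab_group_add \<Rightarrow>\<^sub>0 's::semiring_1"
  shows "single n 1 * f = 0 \<longleftrightarrow> f = 0"
  by (metis mult_zero_right single_one_cancel)

text \<open>Centrality of X^n pulls it out of a right factor; for a left factor
  \<open>mult.assoc\<close> is enough.\<close>

lemma shift_mult_left:
  fixes f g :: "'a::ab_group_add \<Rightarrow>\<^sub>0 's::semiring_1"
  shows "f * (single n 1 * g) = single n 1 * (f * g)"
  by (simp only: single_one_commute[of n g] single_one_commute[of n "f * g"] mult.assoc)

text \<open>A monomial of exponent k is cleared by X^|k|. For a sum, the product of the powers that
  clear the two summands works.\<close>

lemma shift_into_poly:
  fixes f :: "'s::semiring_1 laurent_polynomial"
  shows "\<exists>n p. single (int n) 1 * f = laurent_of_poly p"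
proof (induction f rule: poly_mapping_single_add_induct)
  case (single k a)
  have "0 \<le> \<bar>k\<bar> + k" by linarith
  then have "single (int (nat \<bar>k\<bar>)) 1 * single k a = laurent_of_poly (single (nat (\<bar>k\<bar> + k)) a)"
    by (simp add: mult_single laurent_of_poly_single)
  then show ?case by blast
next
  case (add f g)
  then obtain m p n q where p: "single (int m) 1 * f = laurent_of_poly p"
    and q: "single (int n) 1 * g = laurent_of_poly q" by blast
  have shift: "single (int (m + n)) (1::'s) = single (int m) 1 * single (int n) 1"
    by (simp add: mult_single)
  have "single (int (m + n)) 1 * (f + g)
      = single (int n) 1 * (single (int m) 1 * f) + single (int m) 1 * (single (int n) 1 * g)"
    \<comment> \<open>The instance of \<open>shift_mult_left\<close> swaps X^m and X^n in front of
      \<open>f\<close>, so that X^m meets \<open>f\<close> first.\<close>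
    by (simp only: distrib_left shift mult.assoc
        shift_mult_left[of "single (int m) 1" "int n" f])
  also have "\<dots> = laurent_of_poly (single n 1 * p + single m 1 * q)"
    by (simp add: p q laurent_of_poly_add laurent_of_poly_mult laurent_of_poly_single)
  finally show ?case by blast
qed

text \<open>The same witness serves both sides: (X^n f) x = X^n (f x), and the unit X^n
  cancels.\<close>

lemma left_zero_divisor_shift:
  fixes f :: "'a::ab_group_add \<Rightarrow>\<^sub>0 's::semiring_1"
  shows "single n 1 * f \<in> left_zero_divisors \<longleftrightarrow> f \<in> left_zero_divisors"
  by (simp add: left_zero_divisors_def mult.assoc)

lemma right_zero_divisor_shift:
  fixes f :: "'a::ab_group_add \<Rightarrow>\<^sub>0 's::semiring_1"
  shows "single n 1 * f \<in> right_zero_divisors \<longleftrightarrow> f \<in> right_zero_divisors"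
  by (simp add: right_zero_divisors_def shift_mult_left)

text \<open>A Laurent witness \<open>f\<close> becomes a polynomial witness after multiplication by
  some X^n, which keeps it nonzero. Conversely, the injective embedding carries witnesses
  over.\<close>

lemma left_zero_divisor_laurent_of_poly:
  "laurent_of_poly p \<in> left_zero_divisors \<longleftrightarrow> p \<in> left_zero_divisors"
proof
  assume "laurent_of_poly p \<in> left_zero_divisors"
  then obtain f where f: "f \<noteq> 0" "laurent_of_poly p * f = 0"
    by (auto simp: left_zero_divisors_def)
  obtain n q where q: "single (int n) 1 * f = laurent_of_poly q" using shift_into_poly by blast
  have "laurent_of_poly (p * q) = 0"
    by (simp only: laurent_of_poly_mult shift_mult_left f mult_zero_right flip: q)
  moreover have "q \<noteq> 0" using f(1) q by (metis laurent_of_poly_zero single_one_mult_eq_0_iff)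
  ultimately show "p \<in> left_zero_divisors" by (auto simp: left_zero_divisors_def)
next
  assume "p \<in> left_zero_divisors"
  then obtain q where "q \<noteq> 0" "p * q = 0" by (auto simp: left_zero_divisors_def)
  then have "laurent_of_poly q \<noteq> 0" "laurent_of_poly p * laurent_of_poly q = 0"
    by (simp_all flip: laurent_of_poly_mult)
  then show "laurent_of_poly p \<in> left_zero_divisors"
    unfolding left_zero_divisors_def by blast
qed

lemma right_zero_divisor_laurent_of_poly:
  "laurent_of_poly p \<in> right_zero_divisors \<longleftrightarrow> p \<in> right_zero_divisors"
proof
  assume "laurent_of_poly p \<in> right_zero_divisors"
  then obtain f where f: "f \<noteq> 0" "f * laurent_of_poly p = 0"
    by (auto simp: right_zero_divisors_def)
  obtain n q where q: "single (int n) 1 * f = laurent_of_poly q" using shift_into_poly by blast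
  have "laurent_of_poly (q * p) = 0"
    \<comment> \<open>Here X^n is already leftmost in the product, so associativity alone
      suffices.\<close>
    by (simp add: laurent_of_poly_mult mult.assoc f flip: q)
  moreover have "q \<noteq> 0" using f(1) q by (metis laurent_of_poly_zero single_one_mult_eq_0_iff)
  ultimately show "p \<in> right_zero_divisors" by (auto simp: right_zero_divisors_def)
next
  assume "p \<in> right_zero_divisors"
  then obtain q where "q \<noteq> 0" "q * p = 0" by (auto simp: right_zero_divisors_def)
  then have "laurent_of_poly q \<noteq> 0" "laurent_of_poly q * laurent_of_poly p = 0"
    by (simp_all flip: laurent_of_poly_mult)
  then show "laurent_of_poly p \<in> right_zero_divisors"
    unfolding right_zero_divisors_def by blast
qed

lemma reversible_poly_iff_laurent:
  "reversible TYPE('s::semiring_1 polynomial) \<longleftrightarrow> reversible TYPE('s laurent_polynomial)"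
proof
  assume rev: "reversible TYPE('s polynomial)"
  show "reversible TYPE('s laurent_polynomial)"
    unfolding reversible_def
  proof (intro allI impI)
    fix f g :: "'s laurent_polynomial"
    assume "f * g = 0"
    obtain m p where p: "single (int m) 1 * f = laurent_of_poly p" using shift_into_poly by blast
    obtain n q where q: "single (int n) 1 * g = laurent_of_poly q" using shift_into_poly by blast
    \<comment> \<open>Up to the embedding, \<open>p * q\<close> and \<open>q * p\<close> differ from
      \<open>f * g\<close> and \<open>g * f\<close> only by unit factors, so they vanish
      together.\<close>
    have pq: "laurent_of_poly (p * q) = single (int m) 1 * (single (int n) 1 * (f * g))"
      by (simp only: laurent_of_poly_mult mult.assoc shift_mult_left[of f] flip: p q)
    have qp: "laurent_of_poly (q * p) = single (int n) 1 * (single (int m) 1 * (g * f))"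
      by (simp only: laurent_of_poly_mult mult.assoc shift_mult_left[of g] flip: p q)
    have "p * q = 0" using pq \<open>f * g = 0\<close> by simp
    then have "q * p = 0" using rev by (simp add: reversible_def)
    with qp show "g * f = 0" by simp
  qed
next
  assume rev: "reversible TYPE('s laurent_polynomial)"
  show "reversible TYPE('s polynomial)"
    unfolding reversible_def
  proof (intro allI impI)
    fix p q :: "'s polynomial"
    assume "p * q = 0"
    \<comment> \<open>Reversibility is inherited by the image of the embedding, a
      subsemiring.\<close>
    then have "laurent_of_poly p * laurent_of_poly q = 0" by (simp flip: laurent_of_poly_mult)
    then have "laurent_of_poly q * laurent_of_poly p = 0" using rev by (simp add: reversible_def)
    then show "q * p = 0" by (simp flip: laurent_of_poly_mult)
  qed
qed

lemma eversible_poly_iff_laurent: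
  "eversible TYPE('s::semiring_1 polynomial) \<longleftrightarrow> eversible TYPE('s laurent_polynomial)"
proof
  assume ev: "eversible TYPE('s polynomial)"
  have "f \<in> left_zero_divisors \<longleftrightarrow> f \<in> right_zero_divisors" for f :: "'s laurent_polynomial"
  proof -
    obtain n p where p: "single (int n) 1 * f = laurent_of_poly p" using shift_into_poly by blast
    \<comment> \<open>Membership passes from \<open>f\<close> to its shift, the image of
      \<open>p\<close>, and from there to \<open>p\<close> itself.\<close>
    have "f \<in> left_zero_divisors \<longleftrightarrow> p \<in> left_zero_divisors"
      by (metis left_zero_divisor_shift left_zero_divisor_laurent_of_poly p)
    also have "\<dots> \<longleftrightarrow> p \<in> right_zero_divisors" using ev by (simp add: eversible_def)
    also have "\<dots> \<longleftrightarrow> f \<in> right_zero_divisors"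
      by (metis right_zero_divisor_shift right_zero_divisor_laurent_of_poly p)
    finally show ?thesis .
  qed
  then show "eversible TYPE('s laurent_polynomial)" by (auto simp: eversible_def)
next
  assume "eversible TYPE('s laurent_polynomial)"
  \<comment> \<open>Each zero-divisor set of polynomials is the preimage of its Laurent counterpart,
    so equality pulls back.\<close>
  then have "p \<in> left_zero_divisors \<longleftrightarrow> p \<in> right_zero_divisors" for p :: "'s polynomial"
    by (metis eversible_def left_zero_divisor_laurent_of_poly right_zero_divisor_laurent_of_poly)
  then show "eversible TYPE('s polynomial)" by (auto simp: eversible_def)
qed

theorem theorem4p13:
  shows "(reversible TYPE('s::semiring_1 polynomial)
            \<longleftrightarrow> reversible TYPE('s laurent_polynomial))
       \<and> (eversible TYPE('s polynomial)
            \<longleftrightarrow> eversible TYPE('s laurent_polynomial))"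
  using reversible_poly_iff_laurent eversible_poly_iff_laurent by blast

end
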